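(* Let $|\mathcal U|\ge4$ and let $\mathcal D\subseteq\mathcal R^{vNM}$ be a domain satisfying (R5). An anonymous social welfare function $f\colon\mathcal D^N\to\mathcal R^{vNM}$ (with range $\mathcal R^{vNM}$) is Arrovian if and only if $f$ is the utilitarian social welfare function and $\mathcal D\subseteq\mathcal R^{dich}$.
   Context: Outcomes. $\mathcal U$ is a non-empty finite set of alternatives; $\Delta$ is the set of all probability measures on $\mathcal U$. Each $a\in\mathcal U$ is identified with the point mass on $a$. For $X\subseteq\mathcal U$, $\Delta_X=\{p\in\Delta: p(X)=1\}$. Preferences. A preference relation is an asymmetric binary relation $\succ$ on $\Delta$; $p\sim q$ means neither $p\succ q$ nor $q\succ p$; $p\succsim q$ means $p\succ q$ or $p\sim q$. For a set $X$ of outcomes, ${\succ}|_X=\{(p,q)\in{\succ}: p,q\in X\}$. $\mathcal R^{vNM}$ is the set of preference relations $\succ$ for which there is a linear function $u\colon\Delta\to\mathbb R$ (i.e. $u(p)=\sum_{a\in\mathcal U}p(a)u(a)$) with $p\succ q\Leftrightarrow u(p)>u(q)$ for all $p,q\in\Delta$. $\mathcal R^{dich}$ is the set of those ${\succ}\in\mathcal R^{vNM}$ for which $u$ can be chosen with $u(a)\in\{0,1\}$ for all $a\in\mathcal U$ (this includes the empty relation $\emptyset$, complete indifference). SSB functions. An SSB function is a map $\phi\colon\Delta\times\Delta\to\mathbb R$ with $\phi(p,q)=-\phi(q,p)$ that is linear (i.e. preserves convex combinations) in each argument; it represents $\succ$ (written ${\succ}\equiv\phi$) if $p\succ q\Leftrightarrow\phi(p,q)>0$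 for all $p,q\in\Delta$. Representing SSB functions are unique up to multiplication by a positive scalar; a relation in $\mathcal R^{vNM}$ with utility $u$ is represented by $\phi(p,q)=u(p)-u(q)$. $\Phi$ is the set of SSB functions whose largest value is $1$, together with the zero function (which represents $\emptyset$). Social welfare functions. $N=\{1,\dots,n\}$ with $n\ge2$ is the set of agents. A profile is $R=(\succ_1,\dots,\succ_n)\in\mathcal D^N$; restrictions $R|_X$ are componentwise. A social welfare function (SWF) with range $\mathcal R^{vNM}$ is a map $f\colon\mathcal D^N\to\mathcal R^{vNM}$. It satisfies Pareto optimality if for all $p,q\in\Delta$, $R\in\mathcal D^N$ and ${\succ}=f(R)$: $p\succsim_iq$ for all $i\in N$ implies $p\succsim q$, and if additionally $p\succ_iq$ for some $i$ then $p\succ q$. It satisfies IIA if for all $R,\hat R\in\mathcal D^N$ and $X\subseteq\mathcal U$: $R|_{\Delta_X}=\hat R|_{\Delta_X}$ implies $f(R)|_{\Delta_X}=f(\hat R)|_{\Delta_X}$. It is Arrovian if it satisfies Pareto optimality and IIA. It is anonymous if $f(R)=f(R\circ\pi)$ for every $R\in\mathcal D^N$ and every permutation $\pi$ of $N$. The utilitarian SWF on $\mathcal D$ is the one with $f(R)\equiv\sum_{i\in N}\phi_i$ for all $R=(\succ_i)_{i\in N}\in\mathcal D^N$, where $\phi_i\in\Phi$ is the normalized function with ${\succ_i}\equiv\phi_i$. Domain condition (R5): for all ${\hat\succ}\in\mathcal R^{dich}$ and all $X\subseteq\mathcal U$ with $|X|\le4$ there is ${\succ}\in\mathcal D$ such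 that ${\succ}|_X={\hat\succ}|_X$ (restriction to the pure outcomes in $X$). *)

theory Defs
  imports "HOL-Probability.Probability_Mass_Function"
begin

text \<open>
  The set of alternatives is a finite type \<open>'a\<close>, so that lotteries over it form the type
  \<open>'a pmf\<close>; the alternative \<open>a\<close> is identified with \<open>return_pmf a\<close>. The set of agents is a
  finite type \<open>'n\<close>. Social welfare functions are total functions on \<open>'n \<Rightarrow> 'a pref\<close>, and all
  conditions on them are imposed only on profiles with values in the domain \<open>D\<close>.
\<close>

type_synonym 'a pref = "('a pmf \<times> 'a pmf) set"

definition lotteries_on :: "'a set \<Rightarrow> 'a pmf set" where
  "lotteries_on X = {p. measure_pmf.prob p X = 1}"

definition mix :: "real \<Rightarrow> 'a pmf \<Rightarrow> 'a pmf \<Rightarrow> 'a pmf" where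
  "mix l p q = bind_pmf (bernoulli_pmf l) (\<lambda>b. if b then p else q)"

lemma pmf_mix:
  assumes "0 \<le> l" "l \<le> 1"
  shows "pmf (mix l p q) a = l * pmf p a + (1 - l) * pmf q a"
  using assms by (simp add: mix_def pmf_bind)

definition mixture_preserving :: "('a pmf \<Rightarrow> real) \<Rightarrow> bool" where
  "mixture_preserving g \<longleftrightarrow>
     (\<forall>l p q. 0 \<le> l \<and> l \<le> 1 \<longrightarrow> g (mix l p q) = l * g p + (1 - l) * g q)"

definition linear_utility :: "('a::finite pmf \<Rightarrow> real) \<Rightarrow> bool" where
  "linear_utility u \<longleftrightarrow> (\<forall>p. u p = (\<Sum>a\<in>UNIV. pmf p a * u (return_pmf a)))"

definition preference_relation :: "'a pref \<Rightarrow> bool" where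
  "preference_relation r \<longleftrightarrow> asym r"

definition indiff :: "'a pref \<Rightarrow> 'a pmf \<Rightarrow> 'a pmf \<Rightarrow> bool" where
  "indiff r p q \<longleftrightarrow> (p, q) \<notin> r \<and> (q, p) \<notin> r"

definition weakly_prefers :: "'a pref \<Rightarrow> 'a pmf \<Rightarrow> 'a pmf \<Rightarrow> bool" where
  "weakly_prefers r p q \<longleftrightarrow> (p, q) \<in> r \<or> indiff r p q"

definition restrict_pref :: "'a pref \<Rightarrow> 'a pmf set \<Rightarrow> 'a pref" where
  "restrict_pref r Y = r \<inter> Y \<times> Y"

definition utility_represents :: "('a pmf \<Rightarrow> real) \<Rightarrow> 'a pref \<Rightarrow> bool" where
  "utility_represents u r \<longleftrightarrow> (\<forall>p q. (p, q) \<in> r \<longleftrightarrow> u p > u q)"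

definition R_vNM :: "'a::finite pref set" where
  "R_vNM = {r. preference_relation r \<and> (\<exists>u. linear_utility u \<and> utility_represents u r)}"

definition R_dich :: "'a::finite pref set" where
  "R_dich = {r \<in> R_vNM. \<exists>u. linear_utility u \<and> utility_represents u r \<and>
                             (\<forall>a. u (return_pmf a) \<in> {0, 1})}"

definition SSB :: "('a pmf \<Rightarrow> 'a pmf \<Rightarrow> real) \<Rightarrow> bool" where
  "SSB \<phi> \<longleftrightarrow> (\<forall>p q. \<phi> p q = - \<phi> q p) \<and>
            (\<forall>q. mixture_preserving (\<lambda>p. \<phi> p q)) \<and> (\<forall>p. mixture_preserving (\<lambda>q. \<phi> p q))"

definition SSB_represents :: "('a pmf \<Rightarrow> 'a pmf \<Rightarrow> real) \<Rightarrow> 'a pref \<Rightarrow> bool" where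
  "SSB_represents \<phi> r \<longleftrightarrow> (\<forall>p q. (p, q) \<in> r \<longleftrightarrow> \<phi> p q > 0)"

definition normalized_SSB :: "('a pmf \<Rightarrow> 'a pmf \<Rightarrow> real) set" where
  "normalized_SSB = {\<phi>. SSB \<phi> \<and> (\<exists>p q. \<phi> p q = 1) \<and> (\<forall>p q. \<phi> p q \<le> 1)} \<union> {\<lambda>p q. 0}"

definition the_SSB :: "'a pref \<Rightarrow> 'a pmf \<Rightarrow> 'a pmf \<Rightarrow> real" where
  "the_SSB r = (THE \<phi>. \<phi> \<in> normalized_SSB \<and> SSB_represents \<phi> r)"

definition profiles :: "'a pref set \<Rightarrow> ('n \<Rightarrow> 'a pref) set" where
  "profiles D = {R. \<forall>i. R i \<in> D}"

definition SWF :: "'a pref set \<Rightarrow> 'a pref set \<Rightarrow> (('n \<Rightarrow> 'a pref) \<Rightarrow> 'a pref) \<Rightarrow> bool" where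
  "SWF D S f \<longleftrightarrow> (\<forall>R \<in> profiles D. f R \<in> S)"

definition pareto_optimal :: "'a pref set \<Rightarrow> (('n \<Rightarrow> 'a pref) \<Rightarrow> 'a pref) \<Rightarrow> bool" where
  "pareto_optimal D f \<longleftrightarrow>
     (\<forall>R \<in> profiles D. \<forall>p q. (\<forall>i. weakly_prefers (R i) p q) \<longrightarrow>
        weakly_prefers (f R) p q \<and> ((\<exists>i. (p, q) \<in> R i) \<longrightarrow> (p, q) \<in> f R))"

definition IIA :: "'a pref set \<Rightarrow> (('n \<Rightarrow> 'a pref) \<Rightarrow> 'a pref) \<Rightarrow> bool" where
  "IIA D f \<longleftrightarrow>
     (\<forall>R \<in> profiles D. \<forall>R' \<in> profiles D. \<forall>X.
        (\<forall>i. restrict_pref (R i) (lotteries_on X) = restrict_pref (R' i) (lotteries_on X)) \<longrightarrow>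
        restrict_pref (f R) (lotteries_on X) = restrict_pref (f R') (lotteries_on X))"

definition arrovian :: "'a pref set \<Rightarrow> (('n \<Rightarrow> 'a pref) \<Rightarrow> 'a pref) \<Rightarrow> bool" where
  "arrovian D f \<longleftrightarrow> pareto_optimal D f \<and> IIA D f"

definition anonymous :: "'a pref set \<Rightarrow> (('n \<Rightarrow> 'a pref) \<Rightarrow> 'a pref) \<Rightarrow> bool" where
  "anonymous D f \<longleftrightarrow> (\<forall>R \<in> profiles D. \<forall>\<pi>. bij \<pi> \<longrightarrow> f R = f (R \<circ> \<pi>))"

definition utilitarian :: "'a pref set \<Rightarrow> (('n::finite \<Rightarrow> 'a pref) \<Rightarrow> 'a pref) \<Rightarrow> bool" where
  "utilitarian D f \<longleftrightarrow>
     (\<forall>R \<in> profiles D. SSB_represents (\<lambda>p q. \<Sum>i\<in>UNIV. the_SSB (R i) p q) (f R))"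

definition R5 :: "'a::finite pref set \<Rightarrow> bool" where
  "R5 D \<longleftrightarrow>
     (\<forall>r' \<in> R_dich. \<forall>X. card X \<le> 4 \<longrightarrow>
        (\<exists>r \<in> D. restrict_pref r (return_pmf ` X) = restrict_pref r' (return_pmf ` X)))"

lemma linear_utility_mix:
  assumes "linear_utility u" "0 \<le> l" "l \<le> 1"
  shows "u (mix l p q) = l * u p + (1 - l) * u q"
proof -
  have *: "u p' = (\<Sum>a\<in>UNIV. pmf p' a * u (return_pmf a))" for p'
    using assms(1) unfolding linear_utility_def by blast
  have "u (mix l p q) =
      (\<Sum>a\<in>UNIV. l * (pmf p a * u (return_pmf a)) + (1 - l) * (pmf q a * u (return_pmf a)))"
    unfolding *[of "mix l p q"] pmf_mix[OF assms(2,3)]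
    by (intro sum.cong) (auto simp: algebra_simps)
  also have "\<dots> = l * u p + (1 - l) * u q"
    unfolding *[of p] *[of q] sum.distrib sum_distrib_left ..
  finally show ?thesis .
qed

lemma linear_utility_bounds:
  fixes u :: "'a::finite pmf \<Rightarrow> real"
  assumes "linear_utility u"
  shows "\<exists>a b. \<forall>p. u (return_pmf b) \<le> u p \<and> u p \<le> u (return_pmf a)"
proof -
  let ?g = "\<lambda>a. u (return_pmf a)"
  have "Max (range ?g) \<in> range ?g" by (intro Max_in) auto
  then obtain a where "Max (range ?g) = ?g a" by blast
  hence a: "?g x \<le> ?g a" for x by (metis Max_ge finite finite_imageI rangeI)
  have "Min (range ?g) \<in> range ?g" by (intro Min_in) auto
  then obtain b where "Min (range ?g) = ?g b" by blast
  hence b: "?g b \<le> ?g x" for x by (metis Min_le finite finite_imageI rangeI)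
  have s: "(\<Sum>x\<in>UNIV. pmf p x) = 1" for p :: "'a pmf"
    by (rule sum_pmf_eq_1) auto
  have "u p \<le> ?g a \<and> ?g b \<le> u p" for p
  proof -
    have u: "u p = (\<Sum>x\<in>UNIV. pmf p x * ?g x)"
      using assms unfolding linear_utility_def by blast
    have "u p \<le> (\<Sum>x\<in>UNIV. pmf p x * ?g a)" "(\<Sum>x\<in>UNIV. pmf p x * ?g b) \<le> u p"
      unfolding u by (auto intro!: sum_mono mult_left_mono a b)
    thus ?thesis by (simp add: sum_distrib_right[symmetric] s)
  qed
  thus ?thesis by blast
qed

lemma SSB_mix:
  assumes "SSB \<phi>" "0 \<le> l" "l \<le> 1"
  shows "\<phi> (mix l p q) s = l * \<phi> p s + (1 - l) * \<phi> q s"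
    and "\<phi> s (mix l p q) = l * \<phi> s p + (1 - l) * \<phi> s q"
  using assms unfolding SSB_def mixture_preserving_def by blast+

lemma SSB_same:
  assumes "SSB \<phi>" shows "\<phi> p p = 0"
proof -
  have "\<phi> p p = - \<phi> p p" using assms unfolding SSB_def by blast
  thus ?thesis by simp
qed

lemma SSB_of_utility:
  assumes "linear_utility u" and rep: "utility_represents u r"
    and \<phi>: "SSB \<phi>" "SSB_represents \<phi> r"
  shows "\<exists>c. \<forall>p q. \<phi> p q = c * (u p - u q)"
proof -
  have skew: "\<phi> p q = - \<phi> q p" for p q
    using \<phi>(1) unfolding SSB_def by blast
  have pos: "\<phi> p q > 0 \<longleftrightarrow> u p > u q" for p q
    using \<phi>(2) rep by (auto simp: SSB_represents_def utility_represents_def)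
  have zero: "\<phi> p q = 0" if "u p = u q" for p q
    using pos[of p q] pos[of q p] skew[of p q] that by force
  have indep: "\<phi> p s = \<phi> q s" if pq: "u p = u q" for p q s
  proof -
    have "u (mix (1/2) s p) = u (mix (1/2) s q)"
      by (simp add: linear_utility_mix[OF assms(1)] pq)
    hence "\<phi> (mix (1/2) s p) (mix (1/2) s q) = 0" by (rule zero)
    hence "\<phi> s q + \<phi> p s = 0"
      by (simp add: SSB_mix[OF \<phi>(1)] SSB_same[OF \<phi>(1)] zero[OF pq])
    thus ?thesis using skew[of q s] by simp
  qed
  obtain a b where "\<forall>p. u (return_pmf b) \<le> u p \<and> u p \<le> u (return_pmf a)"
    using linear_utility_bounds[OF assms(1)] by blast
  hence ab: "u (return_pmf b) \<le> u p" "u p \<le> u (return_pmf a)" for p by blast+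
  let ?a = "return_pmf a" and ?b = "return_pmf b"
  show ?thesis
  proof (cases "u ?a = u ?b")
    case True
    hence "u p = u ?b" for p using ab[of p] by simp
    hence "u p = u q" for p q by metis
    hence "\<phi> p q = 0 * (u p - u q)" for p q using zero[of p q] by simp
    thus ?thesis by blast
  next
    case False
    define d where "d = u ?a - u ?b"
    have d: "d > 0" using False ab(1)[of ?a] by (simp add: d_def)
    define l where "l p = (u p - u ?b) / d" for p
    have l: "0 \<le> l p" "l p \<le> 1" for p
      using ab[of p] d by (auto simp: l_def d_def field_simps)
    have um: "u (mix (l p) ?a ?b) = u p" for p
    proof -
      have "u (mix (l p) ?a ?b) = l p * d + u ?b"
        by (simp add: linear_utility_mix[OF assms(1) l] d_def algebra_simps)
      also have "\<dots> = u p" using d by (simp add: l_def)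
      finally show ?thesis .
    qed
    have "\<phi> p q = \<phi> ?a ?b / d * (u p - u q)" for p q
    proof -
      have "\<phi> p q = \<phi> (mix (l p) ?a ?b) (mix (l q) ?a ?b)"
        using indep[OF um, of p q] indep[OF um, of q "mix (l p) ?a ?b"]
          skew[of "mix (l p) ?a ?b" "mix (l q) ?a ?b"] skew[of "mix (l p) ?a ?b" q] by linarith
      also have "\<dots> = (l p - l q) * \<phi> ?a ?b"
        using skew[of ?b ?a]
        by (simp add: SSB_mix[OF \<phi>(1) l] SSB_same[OF \<phi>(1)] algebra_simps)
      also have "l p - l q = (u p - u q) / d"
        by (simp add: l_def diff_divide_distrib)
      finally show ?thesis by simp
    qed
    thus ?thesis by blast
  qed
qed

lemma SSB_zero: "SSB (\<lambda>p q. 0)"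
  by (simp add: SSB_def mixture_preserving_def)

lemma ex1_normalized_SSB:
  assumes "r \<in> R_vNM"
  shows "\<exists>!\<phi>. \<phi> \<in> normalized_SSB \<and> SSB_represents \<phi> r"
proof -
  obtain u where lin: "linear_utility u" and rep: "utility_represents u r"
    using assms by (auto simp: R_vNM_def)
  obtain a b where "\<forall>p. u (return_pmf b) \<le> u p \<and> u p \<le> u (return_pmf a)"
    using linear_utility_bounds[OF lin] by blast
  hence ab: "u (return_pmf b) \<le> u p" "u p \<le> u (return_pmf a)" for p by blast+
  let ?d = "u (return_pmf a) - u (return_pmf b)"
  have ssb: "SSB (\<lambda>p q. c * (u p - u q))" for c
    by (auto simp: SSB_def mixture_preserving_def linear_utility_mix[OF lin] algebra_simps)
  have rep': "(p, q) \<in> r \<longleftrightarrow> u p > u q" for p q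
    using rep by (simp add: utility_represents_def)
  show ?thesis
  proof (cases "?d = 0")
    case True
    have const: "u p = u (return_pmf b)" for p using ab[of p] True by simp
    have "\<phi> = (\<lambda>p q. 0)" if prems: "\<phi> \<in> normalized_SSB" "SSB_represents \<phi> r" for \<phi>
    proof -
      have "SSB \<phi>" using prems SSB_zero by (auto simp: normalized_SSB_def)
      then obtain c where "\<forall>p q. \<phi> p q = c * (u p - u q)"
        using SSB_of_utility[OF lin rep _ prems(2)] by blast
      moreover have "u p - u q = 0" for p q using const[of p] const[of q] by simp
      ultimately show ?thesis by (simp add: fun_eq_iff)
    qed
    moreover have "SSB_represents (\<lambda>p q. 0) r"
      unfolding SSB_represents_def rep' using const by (metis less_irrefl)
    ultimately show ?thesis
      by (intro ex1I[of _ "\<lambda>p q. 0"]) (auto simp: normalized_SSB_def)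
  next
    case False
    hence d: "?d > 0" using ab(1)[of "return_pmf a"] by simp
    have le: "u p - u q \<le> ?d" for p q using ab(1)[of q] ab(2)[of p] by simp
    let ?\<phi> = "\<lambda>p q. 1 / ?d * (u p - u q)"
    show ?thesis
    proof (rule ex1I[of _ ?\<phi>], intro conjI)
      have "?\<phi> (return_pmf a) (return_pmf b) = 1" using d by simp
      moreover have "?\<phi> p q \<le> 1" for p q using le[of p q] d by simp
      ultimately show "?\<phi> \<in> normalized_SSB"
        unfolding normalized_SSB_def using ssb[of "1 / ?d"] by blast
      show "SSB_represents ?\<phi> r"
        using d by (auto simp: SSB_represents_def rep' zero_less_divide_iff)
    next
      fix \<phi> assume \<phi>: "\<phi> \<in> normalized_SSB \<and> SSB_represents \<phi> r"
      have "SSB \<phi>" using \<phi> SSB_zero by (auto simp: normalized_SSB_def)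
      then obtain c where "\<forall>p q. \<phi> p q = c * (u p - u q)"
        using SSB_of_utility[OF lin rep _ conjunct2[OF \<phi>]] by blast
      hence c: "\<phi> p q = c * (u p - u q)" for p q by blast
      have "\<phi> (return_pmf a) (return_pmf b) > 0"
        using \<phi> d rep' by (auto simp: SSB_represents_def)
      hence cpos: "c > 0" using d by (simp add: c zero_less_mult_iff)
      have "\<phi> \<noteq> (\<lambda>p q. 0)" using \<open>\<phi> (return_pmf a) (return_pmf b) > 0\<close> by auto
      then obtain p q where pq: "\<phi> p q = 1" and max: "\<And>p q. \<phi> p q \<le> 1"
        using \<phi> by (auto simp: normalized_SSB_def)
      have "c * (u p - u q) \<le> c * ?d"
        by (rule mult_left_mono[OF le]) (use cpos in simp)
      hence "1 \<le> c * ?d" using pq c by metis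
      moreover have "c * ?d \<le> 1" using max c by metis
      ultimately have "c * ?d = 1" by linarith
      hence "c = 1 / ?d" using d by (simp add: field_simps)
      thus "\<phi> = ?\<phi>" by (simp add: fun_eq_iff c)
    qed
  qed
qed

lemma the_SSB:
  assumes "r \<in> R_vNM"
  shows "the_SSB r \<in> normalized_SSB" "SSB_represents (the_SSB r) r"
  using theI'[OF ex1_normalized_SSB[OF assms]] by (auto simp: the_SSB_def)

end

theory Submission
  imports Defs
begin

text \<open>
  Pareto makes clones socially indifferent, so with IIA the social ranking of a pair is neutral;
  with anonymity a pair supported by equally many agents on both sides is a tie. If some
  preference in the domain has three levels \<open>a > b > c\<close>, pair it with one opponent approving
  exactly \<open>b\<close> and \<open>c\<close>: both pairs \<open>a, b\<close> and \<open>a, c\<close> are ties, but \<open>b\<close> Pareto-dominates \<open>c\<close>. Hence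
  all preferences are dichotomous. For these, ties imply that approval counts determine the social
  ranking of alternatives. For counts \<open>k + 1, k, k - 1\<close> with nested approval sets, a fourth
  alternative completes a parallelogram in which Pareto indifference of two even-chance lotteries
  forces equal social utility differences; adding intermediate alternatives one at a time extends
  this to arbitrary triples of counts, so social utility is an affine function of the approval
  counts.
\<close>

section \<open>Utilities of vNM preferences and their affine agreement on lotteries\<close>

text \<open>Representing utilities are unique only up to positive affine maps; fixing one lets
  social comparisons be handled as real arithmetic.\<close>

definition util :: "'a::finite pref \<Rightarrow> 'a pmf \<Rightarrow> real" where
  "util r = (SOME u. linear_utility u \<and> utility_represents u r)"

abbreviation val :: "'a::finite pref \<Rightarrow> 'a \<Rightarrow> real" where
  "val r a \<equiv> util r (return_pmf a)"

lemma
  assumes "r \<in> R_vNM"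
  shows linear_util: "linear_utility (util r)"
    and util_represents: "(p, q) \<in> r \<longleftrightarrow> util r p > util r q"
proof -
  have "\<exists>u. linear_utility u \<and> utility_represents u r"
    using assms by (simp add: R_vNM_def)
  from someI_ex[OF this, folded util_def]
  show "linear_utility (util r)" "(p, q) \<in> r \<longleftrightarrow> util r p > util r q"
    unfolding utility_represents_def by blast+
qed

lemma R_vNM_I:
  assumes "linear_utility u" "utility_represents u r"
  shows "r \<in> R_vNM"
  using assms
  by (auto simp: R_vNM_def preference_relation_def utility_represents_def intro!: asymI)

lemma R_dich_I:
  assumes "linear_utility u" "utility_represents u r" "\<And>a. u (return_pmf a) \<in> {0, 1}"
  shows "r \<in> R_dich"
  unfolding R_dich_def using R_vNM_I[OF assms(1,2)] assms by blast

lemma linear_utility_extension: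
  fixes g :: "'a::finite \<Rightarrow> real"
  shows "linear_utility (\<lambda>p. \<Sum>a\<in>UNIV. pmf p a * g a)"
    and "(\<Sum>a\<in>UNIV. pmf (return_pmf x) a * g a) = g x"
proof -
  show *: "(\<Sum>a\<in>UNIV. pmf (return_pmf x) a * g a) = g x" for x
    by (simp add: indicator_def if_distrib[of "\<lambda>t. t * _"] cong: if_cong)
  show "linear_utility (\<lambda>p. \<Sum>a\<in>UNIV. pmf p a * g a)"
    unfolding linear_utility_def * by blast
qed

lemma lotteries_on_iff: "p \<in> lotteries_on X \<longleftrightarrow> set_pmf p \<subseteq> X"
  by (auto simp: lotteries_on_def measure_pmf.prob_eq_1 AE_measure_pmf_iff)

lemma return_pmf_lotteries_on [simp]: "return_pmf a \<in> lotteries_on X \<longleftrightarrow> a \<in> X"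
  by (simp add: lotteries_on_iff)

lemma mix_lotteries_on:
  assumes "p \<in> lotteries_on X" "q \<in> lotteries_on X"
  shows "mix l p q \<in> lotteries_on X"
  using assms by (auto simp: lotteries_on_iff mix_def split: if_splits)

text \<open>Alternatives outside \<open>X\<close> carry no weight, and the constant \<open>d\<close>
  is collected with total weight 1. Agreement on pure alternatives thus passes to lotteries.\<close>

lemma affine_utility_on_lotteries:
  assumes u: "linear_utility u" "linear_utility u'"
    and aff: "\<And>x. x \<in> X \<Longrightarrow> u' (return_pmf x) = c * u (return_pmf x) + d"
    and p: "p \<in> lotteries_on X"
  shows "u' p = c * u p + d"
proof -
  have s: "(\<Sum>x\<in>UNIV. pmf p x) = 1"
    by (rule sum_pmf_eq_1) auto
  have "pmf p a * u' (return_pmf a) = c * (pmf p a * u (return_pmf a)) + pmf p a * d" for a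
  proof (cases "a \<in> X")
    case False
    hence "pmf p a = 0" using p by (auto simp: lotteries_on_iff set_pmf_eq)
    thus ?thesis by simp
  qed (simp add: aff algebra_simps)
  hence "(\<Sum>a\<in>UNIV. pmf p a * u' (return_pmf a)) =
      c * (\<Sum>a\<in>UNIV. pmf p a * u (return_pmf a)) + (\<Sum>a\<in>UNIV. pmf p a) * d"
    by (simp add: sum.distrib sum_distrib_left sum_distrib_right)
  thus ?thesis
    using u[unfolded linear_utility_def, THEN spec, of p] s by (metis mult_1)
qed

text \<open>With at most two utility levels on \<open>X\<close>, the ranking of pure alternatives
  fixes the utility on \<open>X\<close> up to a positive affine map, hence also the ranking of
  lotteries. The premise of IIA can then be checked on pure alternatives.\<close>

lemma two_valued_restrict_eq:
  assumes r: "r \<in> R_vNM" "r' \<in> R_vNM"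
    and same: "\<And>x y. x \<in> X \<Longrightarrow> y \<in> X \<Longrightarrow> val r x > val r y \<longleftrightarrow> val r' x > val r' y"
    and two: "\<And>x y z. x \<in> X \<Longrightarrow> y \<in> X \<Longrightarrow> z \<in> X \<Longrightarrow> val r x > val r y \<Longrightarrow> val r y > val r z \<Longrightarrow> False"
  shows "restrict_pref r (lotteries_on X) = restrict_pref r' (lotteries_on X)"
proof -
  have "\<exists>c d. c > 0 \<and> (\<forall>x\<in>X. val r' x = c * val r x + d)"
  proof (cases "\<exists>a\<in>X. \<exists>b\<in>X. val r a > val r b")
    case True
    then obtain a b where ab: "a \<in> X" "b \<in> X" "val r a > val r b" by blast
    hence ab': "val r' a > val r' b" using same by blast
    \<comment> \<open>The ratio of the gaps between the upper and the lower level.\<close>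
    define c where "c = (val r' a - val r' b) / (val r a - val r b)"
    have c: "c > 0" using ab ab' by (simp add: c_def)
    have "c * (val r a - val r b) = val r' a - val r' b" using ab by (simp add: c_def)
    hence ca: "val r' a = c * val r a + (val r' b - c * val r b)" by (simp add: algebra_simps)
    have "val r' x = c * val r x + (val r' b - c * val r b)" if x: "x \<in> X" for x
    proof -
      \<comment> \<open>By \<open>two\<close>, no level lies above that of \<open>a\<close>, below
        that of \<open>b\<close>, or strictly between them.\<close>
      consider "val r x = val r a" | "val r x = val r b"
        using two[of x a b] two[of a x b] two[of a b x] x ab by (meson linorder_neqE)
      thus ?thesis
      proof cases
        case 1
        hence "val r' x = val r' a" using same[of x a] same[of a x] x ab by simp
        thus ?thesis using ca 1 by simp
      next
        case 2
        hence "val r' x = val r' b" using same[of x b] same[of b x] x ab by simp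
        thus ?thesis using 2 by simp
      qed
    qed
    thus ?thesis using c by blast
  next
    case False
    show ?thesis
    proof (cases "X = {}")
      case False
      then obtain b where b: "b \<in> X" by blast
      have "val r' x = 1 * val r x + (val r' b - val r b)" if "x \<in> X" for x
      proof -
        have "val r x = val r b" using \<open>\<not> (\<exists>a\<in>X. _)\<close> that b by (meson linorder_neqE)
        moreover from this have "val r' x = val r' b"
          using same[of x b] same[of b x] that b by simp
        ultimately show ?thesis by simp
      qed
      thus ?thesis using zero_less_one by blast
    qed (auto intro: zero_less_one)
  qed
  then obtain c d where c: "c > 0" and d: "\<And>x. x \<in> X \<Longrightarrow> val r' x = c * val r x + d" by blast
  have "util r' p = c * util r p + d" if "p \<in> lotteries_on X" for p
    using affine_utility_on_lotteries[OF r[THEN linear_util] d that] .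
  hence "(p, q) \<in> r \<longleftrightarrow> (p, q) \<in> r'" if "p \<in> lotteries_on X" "q \<in> lotteries_on X" for p q
    using that c by (simp add: r[THEN util_represents])
  thus ?thesis by (auto simp: restrict_pref_def)
qed

section \<open>The utilitarian rule on a dichotomous domain is Arrovian\<close>

text \<open>Differences of a 0/1 utility are already normalized: their maximum is 1 if both values
  occur, and otherwise they vanish. Uniqueness of the normalized function does the rest.\<close>

lemma the_SSB_dichotomous:
  assumes lin: "linear_utility u" and rep: "utility_represents u r"
    and dich: "\<And>a. u (return_pmf a) \<in> {0, 1}"
  shows "the_SSB r = (\<lambda>p q. u p - u q)"
proof -
  obtain a b where ab: "\<And>p. u (return_pmf b) \<le> u p" "\<And>p. u p \<le> u (return_pmf a)"
    using linear_utility_bounds[OF lin] by metis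
  have "SSB (\<lambda>p q. u p - u q)"
    by (auto simp: SSB_def mixture_preserving_def linear_utility_mix[OF lin] algebra_simps)
  moreover have "u p - u q \<le> 1" for p q
    using ab(1)[of q] ab(2)[of p] dich[of a] dich[of b] by auto
  moreover have "(\<lambda>p q. u p - u q) = (\<lambda>p q. 0)" if "\<not> (\<exists>p q. u p - u q = 1)"
  proof -
    have "u (return_pmf a) = u (return_pmf b)"
      using that[unfolded not_ex, THEN spec, THEN spec, of "return_pmf a" "return_pmf b"]
        dich[of a] dich[of b] ab(1)[of "return_pmf a"] by auto
    hence "u p = u q" for p q
      using ab(1)[of p] ab(2)[of p] ab(1)[of q] ab(2)[of q] by simp
    thus ?thesis by (simp add: fun_eq_iff)
  qed
  ultimately have "(\<lambda>p q. u p - u q) \<in> normalized_SSB"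
    unfolding normalized_SSB_def by blast
  moreover have "SSB_represents (\<lambda>p q. u p - u q) r"
    using rep by (simp add: SSB_represents_def utility_represents_def)
  ultimately show ?thesis
    unfolding the_SSB_def using ex1_normalized_SSB[OF R_vNM_I[OF lin rep]]
    by (intro the1_equality) blast+
qed

lemma weakly_prefers_iff:
  assumes "utility_represents u r"
  shows "weakly_prefers r p q \<longleftrightarrow> u p \<ge> u q"
  using assms by (auto simp: weakly_prefers_def indiff_def utility_represents_def)

text \<open>Pareto optimality follows by summing individual utility differences. For IIA, the
  ranking on \<open>X\<close> determines all differences of 0/1 utilities on \<open>X\<close>, hence
  their sum.\<close>

lemma utilitarian_imp_arrovian:
  fixes D :: "'a::finite pref set" and f :: "('n::finite \<Rightarrow> 'a pref) \<Rightarrow> 'a pref"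
  assumes ut: "utilitarian D f" and D: "D \<subseteq> R_dich"
  shows "arrovian D f"
proof -
  \<comment> \<open>\<open>util\<close> may be scaled differently, so a 0/1 utility is chosen
    separately for each dichotomous relation.\<close>
  have "\<forall>r :: 'a pref. \<exists>u. r \<in> R_dich \<longrightarrow>
      linear_utility u \<and> utility_represents u r \<and> (\<forall>a. u (return_pmf a) \<in> {0, 1})"
    unfolding R_dich_def by blast
  from choice[OF this] obtain u where u: "\<forall>r :: 'a pref. r \<in> R_dich \<longrightarrow>
      linear_utility (u r) \<and> utility_represents (u r) r \<and> (\<forall>a. u r (return_pmf a) \<in> {0, 1})" ..
  have lin: "linear_utility (u (R i))" and rep: "utility_represents (u (R i)) (R i)"
    and dich: "u (R i) (return_pmf a) \<in> {0, 1}" if "R \<in> profiles D" for R :: "'n \<Rightarrow> 'a pref" and i a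
    using u[THEN spec, of "R i"] that D by (auto simp: profiles_def)
  have f: "(p, q) \<in> f R \<longleftrightarrow> (\<Sum>i\<in>UNIV. u (R i) p - u (R i) q) > 0"
    if "R \<in> profiles D" for R p q
    using ut that by (simp add: utilitarian_def SSB_represents_def
        the_SSB_dichotomous[OF lin[OF that] rep[OF that] dich[OF that]])
  have "pareto_optimal D f"
    unfolding pareto_optimal_def
  proof (intro ballI allI impI conjI)
    fix R :: "'n \<Rightarrow> 'a pref" and p q assume R: "R \<in> profiles D" and *: "\<forall>i. weakly_prefers (R i) p q"
    have le: "u (R i) p - u (R i) q \<ge> 0" for i
      using * weakly_prefers_iff[OF rep[OF R]] by fastforce
    have "(\<Sum>i\<in>UNIV. u (R i) p - u (R i) q) \<ge> 0" by (intro sum_nonneg le)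
    hence "\<not> (\<Sum>i\<in>UNIV. u (R i) q - u (R i) p) > 0" by (simp add: sum_subtractf)
    thus "weakly_prefers (f R) p q"
      unfolding weakly_prefers_def indiff_def using f[OF R] by blast
    assume "\<exists>i. (p, q) \<in> R i"
    then obtain i where "(p, q) \<in> R i" ..
    hence "u (R i) p - u (R i) q > 0" using rep[OF R, of i] by (simp add: utility_represents_def)
    thus "(p, q) \<in> f R" unfolding f[OF R] by (intro sum_pos2[of _ i] le) auto
  qed
  moreover have "IIA D f"
    unfolding IIA_def
  proof (intro ballI allI impI)
    fix R R' :: "'n \<Rightarrow> 'a pref" and X
    assume R: "R \<in> profiles D" "R' \<in> profiles D"
      and *: "\<forall>i. restrict_pref (R i) (lotteries_on X) = restrict_pref (R' i) (lotteries_on X)"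
    have ord: "u (R i) p > u (R i) q \<longleftrightarrow> u (R' i) p > u (R' i) q"
      if pq: "p \<in> lotteries_on X" "q \<in> lotteries_on X" for i p q
    proof -
      have "(p, q) \<in> restrict_pref (R i) (lotteries_on X) \<longleftrightarrow>
          (p, q) \<in> restrict_pref (R' i) (lotteries_on X)" using * by simp
      thus ?thesis using pq rep[OF R(1), of i] rep[OF R(2), of i]
        by (simp add: restrict_pref_def utility_represents_def)
    qed
    have "u (R i) p - u (R i) q = u (R' i) p - u (R' i) q"
      if pq: "p \<in> lotteries_on X" "q \<in> lotteries_on X" for i p q
    proof -
      obtain b where b: "b \<in> X"
        using pq(1) set_pmf_not_empty[of p] by (auto simp: lotteries_on_iff)
      \<comment> \<open>This shift is 0 unless agent \<open>i\<close> is indifferent throughout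
        \<open>X\<close>; then one utility may be constantly 0 on \<open>X\<close> and the other
        constantly 1.\<close>
      define d where "d = u (R' i) (return_pmf b) - u (R i) (return_pmf b)"
      have "u (R' i) (return_pmf x) = 1 * u (R i) (return_pmf x) + d \<or>
          u (R i) (return_pmf x) = u (R i) (return_pmf b)" if "x \<in> X" for x
        using ord[of "return_pmf x" "return_pmf b" i] ord[of "return_pmf b" "return_pmf x" i] b that
          dich[OF R(1), of i x] dich[OF R(2), of i x] dich[OF R(1), of i b] dich[OF R(2), of i b]
        by (auto simp: d_def)
      hence "u (R' i) (return_pmf x) = 1 * u (R i) (return_pmf x) + d" if "x \<in> X" for x
        using ord[of "return_pmf x" "return_pmf b" i] ord[of "return_pmf b" "return_pmf x" i] b that
        by (force simp: d_def)
      from affine_utility_on_lotteries[OF lin[OF R(1)] lin[OF R(2)] this] pq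
      show ?thesis by simp
    qed
    thus "restrict_pref (f R) (lotteries_on X) = restrict_pref (f R') (lotteries_on X)"
      by (auto simp: restrict_pref_def f R)
  qed
  ultimately show ?thesis by (simp add: arrovian_def)
qed

section \<open>Approval profiles on small sets of alternatives\<close>

locale arrovian_swf =
  fixes D :: "'a::finite pref set" and f :: "('n::finite \<Rightarrow> 'a pref) \<Rightarrow> 'a pref"
  assumes card_alt: "CARD('a) \<ge> 4"
    and D: "D \<subseteq> R_vNM"
    and R5: "R5 D"
    and SWF: "SWF D R_vNM f"
    and anonymous: "anonymous D f"
    and arrovian: "arrovian D f"
begin

abbreviation social :: "('n \<Rightarrow> 'a pref) \<Rightarrow> 'a \<Rightarrow> real" where
  "social R a \<equiv> val (f R) a"

text \<open>\<open>C x\<close> is the set of agents approving \<open>x\<close>. The condition is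
  ordinal and confined to \<open>X\<close> because \<open>R5\<close> controls the domain only on the
  pure outcomes of a small set.\<close>

definition approval_on :: "'a set \<Rightarrow> ('a \<Rightarrow> 'n set) \<Rightarrow> ('n \<Rightarrow> 'a pref) \<Rightarrow> bool" where
  "approval_on X C R \<longleftrightarrow> R \<in> profiles D \<and>
     (\<forall>i. \<forall>x\<in>X. \<forall>y\<in>X. val (R i) x > val (R i) y \<longleftrightarrow> i \<in> C x \<and> i \<notin> C y)"

lemma approval_onD:
  assumes "approval_on X C R" "x \<in> X" "y \<in> X"
  shows "val (R i) x > val (R i) y \<longleftrightarrow> i \<in> C x \<and> i \<notin> C y"
    and "(i \<in> C x \<longleftrightarrow> i \<in> C y) \<Longrightarrow> val (R i) x = val (R i) y"
  using assms unfolding approval_on_def by (blast, meson linorder_neqE)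

lemma approval_on_subset: "approval_on X C R \<Longrightarrow> Y \<subseteq> X \<Longrightarrow> approval_on Y C R"
  unfolding approval_on_def by blast

lemma approval_on_profiles: "approval_on X C R \<Longrightarrow> R \<in> profiles D"
  by (simp add: approval_on_def)

lemma profile_vNM: "R \<in> profiles D \<Longrightarrow> R i \<in> R_vNM"
  using D by (auto simp: profiles_def)

lemma f_vNM: "R \<in> profiles D \<Longrightarrow> f R \<in> R_vNM"
  using SWF by (auto simp: SWF_def)

lemma fresh:
  obtains d :: 'a where "d \<noteq> a" "d \<noteq> b" "d \<noteq> c"
proof -
  have "card {a, b, c} \<le> 3" using card_length[of "[a, b, c]"] by simp
  hence "{a, b, c} \<noteq> UNIV" using card_alt by auto
  thus ?thesis using that by blast
qed

text \<open>For each agent, the indicator of the approved alternatives extends to a 0/1 utility, and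
  \<open>R5\<close> supplies a preference in \<open>D\<close> ranking \<open>X\<close> in the same
  way. The bound 4 leaves room for one auxiliary alternative besides a triple.\<close>

lemma ex_approval_on:
  assumes "card X \<le> 4"
  shows "\<exists>R. approval_on X C R"
proof -
  have "\<exists>r\<in>D. \<forall>x\<in>X. \<forall>y\<in>X. val r x > val r y \<longleftrightarrow> i \<in> C x \<and> i \<notin> C y" for i
  proof -
    define u where "u p = (\<Sum>a\<in>UNIV. pmf p a * of_bool (i \<in> C a))" for p :: "'a pmf"
    have u: "linear_utility u" "u (return_pmf x) = of_bool (i \<in> C x)" for x
      unfolding u_def by (rule linear_utility_extension)+
    define r' where "r' = {(p, q). u p > u q}"
    have "utility_represents u r'" by (simp add: utility_represents_def r'_def)
    hence "r' \<in> R_dich" by (intro R_dich_I[OF u(1)]) (simp_all add: u(2))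
    then obtain r where r: "r \<in> D"
      "restrict_pref r (return_pmf ` X) = restrict_pref r' (return_pmf ` X)"
      using R5 assms unfolding R5_def by blast
    have "val r x > val r y \<longleftrightarrow> i \<in> C x \<and> i \<notin> C y" if "x \<in> X" "y \<in> X" for x y
    proof -
      have "(return_pmf x, return_pmf y) \<in> restrict_pref r (return_pmf ` X) \<longleftrightarrow>
        (return_pmf x, return_pmf y) \<in> restrict_pref r' (return_pmf ` X)" using r by simp
      hence "(return_pmf x, return_pmf y) \<in> r \<longleftrightarrow> u (return_pmf x) > u (return_pmf y)"
        using that by (simp add: restrict_pref_def r'_def)
      moreover have "r \<in> R_vNM" using r D by blast
      ultimately show ?thesis by (simp add: util_represents u of_bool_def)
    qed
    thus ?thesis using r by blast
  qed
  then obtain R where "\<And>i. R i \<in> D"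
    "\<And>i. \<forall>x\<in>X. \<forall>y\<in>X. val (R i) x > val (R i) y \<longleftrightarrow> i \<in> C x \<and> i \<notin> C y" by metis
  thus ?thesis unfolding approval_on_def profiles_def by blast
qed

lemma ex_approval_on_quadruple: "\<exists>R. approval_on {a, b, c, d} C R"
  using card_length[of "[a, b, c, d]"] by (intro ex_approval_on) simp

lemma ex_approval_on_triple: "\<exists>R. approval_on {a, b, c} C R"
  using ex_approval_on_quadruple[of a b c c] by simp

section \<open>Consequences of Pareto optimality and IIA\<close>

lemma
  assumes R: "R \<in> profiles D" and ge: "\<And>i. util (R i) p \<ge> util (R i) q"
  shows pareto_weak: "util (f R) p \<ge> util (f R) q"
    and pareto_strict: "util (R i) p > util (R i) q \<Longrightarrow> util (f R) p > util (f R) q"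
proof -
  have "utility_represents (util r) r" if "r \<in> R_vNM" for r :: "'a pref"
    using that by (simp add: utility_represents_def util_represents)
  note wp = weakly_prefers_iff[OF this]
  have P: "weakly_prefers (f R) p q \<and> ((\<exists>i. (p, q) \<in> R i) \<longrightarrow> (p, q) \<in> f R)"
    using arrovian R ge unfolding arrovian_def pareto_optimal_def
    by (simp add: wp profile_vNM)
  thus "util (f R) p \<ge> util (f R) q" by (simp add: wp f_vNM R)
  show "util (R i) p > util (R i) q \<Longrightarrow> util (f R) p > util (f R) q"
    using P R by (auto simp: util_represents profile_vNM f_vNM)
qed

lemma pareto_indifferent:
  assumes "R \<in> profiles D" "\<And>i. util (R i) p = util (R i) q"
  shows "util (f R) p = util (f R) q"
  using assms by (intro antisym pareto_weak) auto

lemma social_eq: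
  assumes "approval_on X C R" "a \<in> X" "b \<in> X" "C a = C b"
  shows "social R a = social R b"
  using approval_on_profiles[OF assms(1)] approval_onD(2)[OF assms(1-3)] assms(4)
  by (intro pareto_indifferent) simp_all

lemma social_less:
  assumes "approval_on X C R" "a \<in> X" "b \<in> X" "C b \<subset> C a"
  shows "social R b < social R a"
proof -
  obtain i where i: "i \<in> C a" "i \<notin> C b" using assms by blast
  show ?thesis
  proof (rule pareto_strict)
    show "val (R j) b \<le> val (R j) a" for j
      using approval_onD(1)[OF assms(1,3,2), of j] assms(4) by force
    show "val (R i) b < val (R i) a"
      using approval_onD(1)[OF assms(1,2,3)] i by blast
  qed (rule approval_on_profiles[OF assms(1)])
qed

text \<open>Every agent is indifferent between the even-chance lotteries on \<open>a\<close>,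
  \<open>c\<close> and on \<open>b\<close>, \<open>d\<close>, so by Pareto society is too, and
  social utility is linear.\<close>

lemma social_parallelogram:
  assumes R: "approval_on X C R" and X: "a \<in> X" "b \<in> X" "c \<in> X" "d \<in> X"
    and C: "C c \<subseteq> C b" "C b \<subseteq> C a" "C d = C c \<union> (C a - C b)"
  shows "social R a + social R c = social R b + social R d"
proof -
  have RD: "R \<in> profiles D" using R by (rule approval_on_profiles)
  have "val (R i) a + val (R i) c = val (R i) b + val (R i) d" for i
  proof -
    note eq = approval_onD(2)[OF R, of _ _ i]
    \<comment> \<open>Agents in \<open>C a - C b\<close> approve \<open>a\<close> and
      \<open>d\<close> but neither \<open>b\<close> nor \<open>c\<close>; all others treat
      \<open>a\<close> like \<open>b\<close> and \<open>c\<close> like \<open>d\<close>.\<close>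
    have "(i \<in> C a \<longleftrightarrow> i \<in> C b) \<and> (i \<in> C c \<longleftrightarrow> i \<in> C d) \<or>
          (i \<in> C a \<longleftrightarrow> i \<in> C d) \<and> (i \<in> C b \<longleftrightarrow> i \<in> C c)" using C by blast
    thus ?thesis using eq[of a b] eq[of c d] eq[of a d] eq[of b c] X by auto
  qed
  hence "util (f R) (mix (1/2) (return_pmf a) (return_pmf c)) =
      util (f R) (mix (1/2) (return_pmf b) (return_pmf d))"
    by (intro pareto_indifferent RD)
       (simp add: linear_utility_mix[OF linear_util[OF profile_vNM[OF RD]]] field_simps)
  thus ?thesis by (simp add: linear_utility_mix[OF linear_util[OF f_vNM[OF RD]]])
qed

text \<open>IIA with its premise reduced to pure alternatives by
  \<open>two_valued_restrict_eq\<close>. The conclusion covers proper lotteries, which the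
  comparison of utility differences requires.\<close>

lemma social_order_transfer:
  assumes R: "R \<in> profiles D" "R' \<in> profiles D"
    and same: "\<And>i x y. x \<in> X \<Longrightarrow> y \<in> X \<Longrightarrow> val (R i) x > val (R i) y \<longleftrightarrow> val (R' i) x > val (R' i) y"
    and two: "\<And>i x y z. x \<in> X \<Longrightarrow> y \<in> X \<Longrightarrow> z \<in> X \<Longrightarrow>
      val (R i) x > val (R i) y \<Longrightarrow> val (R i) y > val (R i) z \<Longrightarrow> False"
    and pq: "p \<in> lotteries_on X" "q \<in> lotteries_on X"
  shows "util (f R) p > util (f R) q \<longleftrightarrow> util (f R') p > util (f R') q"
proof -
  have "restrict_pref (R i) (lotteries_on X) = restrict_pref (R' i) (lotteries_on X)" for i
    using R same two by (intro two_valued_restrict_eq profile_vNM) blast+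
  hence "restrict_pref (f R) (lotteries_on X) = restrict_pref (f R') (lotteries_on X)"
    using arrovian R unfolding arrovian_def IIA_def by blast
  hence "(p, q) \<in> restrict_pref (f R) (lotteries_on X) \<longleftrightarrow>
      (p, q) \<in> restrict_pref (f R') (lotteries_on X)" by simp
  thus ?thesis using pq R by (simp add: restrict_pref_def util_represents f_vNM)
qed

text \<open>A pair never carries three levels, so this applies before the domain is known to be
  dichotomous.\<close>

lemma pair_transfer:
  assumes "R \<in> profiles D" "R' \<in> profiles D"
    and "\<And>i. val (R i) a > val (R i) b \<longleftrightarrow> val (R' i) a > val (R' i) b"
    and "\<And>i. val (R i) b > val (R i) a \<longleftrightarrow> val (R' i) b > val (R' i) a"
  shows "social R a > social R b \<longleftrightarrow> social R' a > social R' b"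
  using assms by (intro social_order_transfer[where X = "{a, b}"]) auto

lemma approval_transfer:
  assumes R: "approval_on X C R" "approval_on X C' R'" "\<And>x. x \<in> X \<Longrightarrow> C x = C' x"
    and pq: "p \<in> lotteries_on X" "q \<in> lotteries_on X"
  shows "util (f R) p > util (f R) q \<longleftrightarrow> util (f R') p > util (f R') q"
proof (rule social_order_transfer[OF _ _ _ _ pq])
  show "R \<in> profiles D" "R' \<in> profiles D" using R by (auto intro: approval_on_profiles)
  show "val (R i) x > val (R i) y \<longleftrightarrow> val (R' i) x > val (R' i) y" if "x \<in> X" "y \<in> X" for i x y
    using approval_onD(1)[OF R(1) that] approval_onD(1)[OF R(2) that] R(3) that by simp
  show False if "x \<in> X" "y \<in> X" "z \<in> X" "val (R i) x > val (R i) y" "val (R i) y > val (R i) z"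
    for i x y z
    using that approval_onD(1)[OF R(1)] by blast
qed

section \<open>Neutrality and anonymity: ties between equal camps\<close>

text \<open>\<open>A\<close> and \<open>B\<close> are the exact sets of supporters and opponents;
  all other agents are indifferent. No profile fits overlapping sets, hence the disjointness
  assumptions below.\<close>

definition beats :: "'a \<Rightarrow> 'a \<Rightarrow> 'n set \<Rightarrow> 'n set \<Rightarrow> bool" where
  "beats a b A B \<longleftrightarrow> (\<forall>R\<in>profiles D.
     (\<forall>i. val (R i) a > val (R i) b \<longleftrightarrow> i \<in> A) \<longrightarrow> (\<forall>i. val (R i) b > val (R i) a \<longleftrightarrow> i \<in> B) \<longrightarrow>
     social R a > social R b)"

text \<open>By IIA on the pair, a single witnessing profile decides all profiles with the same two
  camps.\<close>

lemma beatsI: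
  assumes "R \<in> profiles D" "social R a > social R b"
    and "\<And>i. val (R i) a > val (R i) b \<longleftrightarrow> i \<in> A" "\<And>i. val (R i) b > val (R i) a \<longleftrightarrow> i \<in> B"
  shows "beats a b A B"
  unfolding beats_def
proof (intro ballI impI)
  fix R' :: "'n \<Rightarrow> 'a pref" assume *: "R' \<in> profiles D"
    "\<forall>i. val (R' i) a > val (R' i) b \<longleftrightarrow> i \<in> A" "\<forall>i. val (R' i) b > val (R' i) a \<longleftrightarrow> i \<in> B"
  show "social R' a > social R' b"
    by (rule iffD1[OF pair_transfer assms(2)]) (simp_all add: assms(1,3,4) *)
qed

lemma beatsD:
  assumes "beats a b A B" "R \<in> profiles D"
    and "\<And>i. val (R i) a > val (R i) b \<longleftrightarrow> i \<in> A" "\<And>i. val (R i) b > val (R i) a \<longleftrightarrow> i \<in> B"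
  shows "social R a > social R b"
  using assms unfolding beats_def by blast

text \<open>A clone of an alternative, approved by the same agents, is socially indifferent to it by
  Pareto; this gives neutrality on pairs.\<close>

lemma beats_clone:
  assumes "beats a b A B" "A \<inter> B = {}" "a \<noteq> b" "c \<noteq> a" "c \<noteq> b"
  shows "beats c b A B" "beats a c A B"
proof -
  obtain R where R: "approval_on {a, b, c} (\<lambda>x. if x = b then B else A) R"
    using ex_approval_on_triple by blast
  have RD: "R \<in> profiles D" using R by (rule approval_on_profiles)
  note o = approval_onD(1)[OF R]
  have "social R a > social R b"
    using assms(2-) by (intro beatsD[OF assms(1) RD]) (auto simp: o)
  moreover have "social R a = social R c" using assms by (intro social_eq[OF R]) auto
  ultimately have "social R c > social R b" by simp
  thus "beats c b A B" using assms(2-) by (intro beatsI[OF RD]) (auto simp: o)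
  obtain R where R: "approval_on {a, b, c} (\<lambda>x. if x = a then A else B) R"
    using ex_approval_on_triple by blast
  have RD: "R \<in> profiles D" using R by (rule approval_on_profiles)
  note o = approval_onD(1)[OF R]
  have "social R a > social R b"
    using assms(2-) by (intro beatsD[OF assms(1) RD]) (auto simp: o)
  moreover have "social R b = social R c" using assms by (intro social_eq[OF R]) auto
  ultimately have "social R a > social R c" by simp
  thus "beats a c A B" using assms(2-) by (intro beatsI[OF RD]) (auto simp: o)
qed

text \<open>Replacing one member at a time by a clone leads from \<open>a, b\<close> via
  \<open>c, b\<close> and \<open>c, a\<close> to \<open>b, a\<close>.\<close>

lemma beats_flip:
  assumes "beats a b A B" "A \<inter> B = {}" "a \<noteq> b"
  shows "beats b a A B"
proof -
  obtain c where c: "c \<noteq> a" "c \<noteq> b" using fresh[of a b b] .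
  have "beats c b A B" using beats_clone(1)[OF assms, of c] c by simp
  hence "beats c a A B" using beats_clone(2)[of c b A B a] assms c by auto
  thus ?thesis using beats_clone(1)[of c a A B b] assms c by auto
qed

text \<open>A bijection from \<open>A\<close> to \<open>B\<close>, its inverse on \<open>B\<close>
  and the identity elsewhere combine to an involution.\<close>

lemma exchange_permutation:
  assumes "A \<inter> B = {}" "card A = card (B :: 'n set)"
  shows "\<exists>\<pi> :: 'n \<Rightarrow> 'n. bij \<pi> \<and> (\<forall>i. \<pi> i \<in> A \<longleftrightarrow> i \<in> B) \<and> (\<forall>i. \<pi> i \<in> B \<longleftrightarrow> i \<in> A)"
proof -
  obtain g where g: "bij_betw g A B"
    using finite_same_card_bij[OF finite finite assms(2)] ..
  define h where "h = inv_into A g"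
  have h: "bij_betw h B A" unfolding h_def using g by (rule bij_betw_inv_into)
  define \<pi> where "\<pi> i = (if i \<in> A then g i else if i \<in> B then h i else i)" for i
  have gB: "g i \<in> B" if "i \<in> A" for i using g that by (auto simp: bij_betw_def)
  have hA: "h i \<in> A" if "i \<in> B" for i using h that by (auto simp: bij_betw_def)
  have gh: "g (h i) = i" if "i \<in> B" for i
    unfolding h_def using g that by (rule bij_betw_inv_into_right)
  have hg: "h (g i) = i" if "i \<in> A" for i
    unfolding h_def using g that by (rule bij_betw_inv_into_left)
  have "\<pi> (\<pi> i) = i" for i
    using assms gB[of i] hA[of i] gh[of i] hg[of i] by (auto simp: \<pi>_def)
  hence "bij \<pi>" by (intro o_bij[of \<pi> \<pi>]) (auto simp: fun_eq_iff)
  moreover have "\<pi> i \<in> A \<longleftrightarrow> i \<in> B" "\<pi> i \<in> B \<longleftrightarrow> i \<in> A" for i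
    using assms gB[of i] hA[of i] by (auto simp: \<pi>_def)
  ultimately show ?thesis by blast
qed

lemma beats_exchange:
  assumes "beats a b A B" "A \<inter> B = {}" "card A = card B"
  shows "beats a b B A"
  unfolding beats_def
proof (intro ballI impI)
  fix R :: "'n \<Rightarrow> 'a pref" assume R: "R \<in> profiles D"
    "\<forall>i. val (R i) a > val (R i) b \<longleftrightarrow> i \<in> B" "\<forall>i. val (R i) b > val (R i) a \<longleftrightarrow> i \<in> A"
  obtain \<pi> where \<pi>: "bij \<pi>" "\<And>i. \<pi> i \<in> A \<longleftrightarrow> i \<in> B" "\<And>i. \<pi> i \<in> B \<longleftrightarrow> i \<in> A"
    using exchange_permutation[OF assms(2,3)] by blast
  have "R \<circ> \<pi> \<in> profiles D" using R(1) by (simp add: profiles_def)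
  hence "social (R \<circ> \<pi>) a > social (R \<circ> \<pi>) b"
    by (rule beatsD[OF assms(1)]) (simp_all add: R(2,3) \<pi>(2,3))
  thus "social R a > social R b"
    using anonymous R(1) \<pi>(1) unfolding anonymous_def by metis
qed

text \<open>If \<open>a\<close> were ahead, neutrality would exchange the alternatives and anonymity
  the two equally large camps, so the same profile would also put \<open>b\<close> ahead.\<close>

lemma social_tie:
  assumes R: "R \<in> profiles D"
    and card: "card {i. val (R i) a > val (R i) b} = card {i. val (R i) b > val (R i) a}"
  shows "social R a = social R b"
proof -
  have no: "\<not> social R a > social R b"
    if card: "card {i. val (R i) a > val (R i) b} = card {i. val (R i) b > val (R i) a}" for a b
  proof
    assume gt: "social R a > social R b"
    hence ne: "a \<noteq> b" by auto
    let ?A = "{i. val (R i) a > val (R i) b}" and ?B = "{i. val (R i) b > val (R i) a}"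
    have dis: "?A \<inter> ?B = {}" by auto
    have "beats a b ?A ?B" by (intro beatsI[OF R gt]) auto
    hence "beats b a ?A ?B" using dis ne by (rule beats_flip)
    hence "beats b a ?B ?A" using dis card by (rule beats_exchange)
    hence "social R b > social R a" using R by (rule beatsD) auto
    thus False using gt by simp
  qed
  show ?thesis using no[OF card] no[OF card[symmetric]] by simp
qed

text \<open>Agents approving both alternatives cancel, leaving camps of equal size.\<close>

lemma approval_tie:
  assumes R: "approval_on X C R" "a \<in> X" "b \<in> X" and card: "card (C a) = card (C b)"
  shows "social R a = social R b"
proof (rule social_tie)
  show "R \<in> profiles D" using R(1) by (rule approval_on_profiles)
  have "{i. val (R i) a > val (R i) b} = C a - C b" "{i. val (R i) b > val (R i) a} = C b - C a"
    using approval_onD(1)[OF R(1,2,3)] approval_onD(1)[OF R(1,3,2)] by auto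
  moreover have "card (C a - C b) = card (C b - C a)"
    using card by (simp add: card_Diff_subset_Int Int_commute)
  ultimately show "card {i. val (R i) a > val (R i) b} = card {i. val (R i) b > val (R i) a}"
    by simp
qed

section \<open>The domain contains only dichotomous preferences\<close>

text \<open>Once three levels are excluded, every alternative lies on the highest or the lowest
  level, and rescaling these gives a 0/1 utility.\<close>

lemma D_subset_R_dich:
  assumes n: "CARD('n) \<ge> 2"
  shows "D \<subseteq> R_dich"
proof
  fix r assume r: "r \<in> D"
  hence rv: "r \<in> R_vNM" using D by blast
  have two: False if gt: "val r a > val r b" "val r b > val r c" for a b c
  proof -
    obtain i j :: 'n where ij: "i \<noteq> j"
      using n by (metis card_1_singleton_iff card.empty UNIV_I one_le_numeral
          card_le_Suc0_iff_eq finite numeral_le_one_iff numeral_2_eq_2 not_less_eq_eq semiring_norm(69))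
    obtain S where S: "approval_on {a, b, c} (\<lambda>x. if x = a then {} else {j}) S"
      using ex_approval_on_triple by blast
    \<comment> \<open>Agent \<open>i\<close> has the three-level preference, \<open>j\<close>
      approves exactly \<open>b\<close> and \<open>c\<close>, and everyone else is indifferent among
      the three.\<close>
    define R where "R = S(i := r)"
    have RD: "R \<in> profiles D"
      using approval_on_profiles[OF S] r by (simp add: R_def profiles_def)
    note o = approval_onD(1)[OF S]
    note e = approval_onD(2)[OF S]
    have ne: "a \<noteq> b" "a \<noteq> c" using gt by auto
    have "{k. val (R k) a > val (R k) x} = {i}" "{k. val (R k) x > val (R k) a} = {j}"
      if "x = b \<or> x = c" for x
      using that gt ij ne o[of a x] o[of x a] by (auto simp: R_def)
    hence "social R a = social R b" "social R a = social R c"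
      using RD by (auto intro!: social_tie)
    moreover have "social R b > social R c"
    proof (rule pareto_strict[OF RD])
      show "val (R k) b \<ge> val (R k) c" for k
        using gt ne e[of b c k] by (auto simp: R_def)
      show "val (R i) b > val (R i) c" using gt by (simp add: R_def)
    qed
    ultimately show False by simp
  qed
  obtain a b where ab: "\<And>p. val r b \<le> util r p" "\<And>p. util r p \<le> val r a"
    using linear_utility_bounds[OF linear_util[OF rv]] by metis
  show "r \<in> R_dich"
  proof (cases "val r a = val r b")
    case True
    hence "util r p = util r q" for p q
      using ab(1)[of p] ab(2)[of p] ab(1)[of q] ab(2)[of q] by simp
    hence "utility_represents (\<lambda>p. 0) r"
      using util_represents[OF rv] by (simp add: utility_represents_def) (metis less_irrefl)
    thus ?thesis by (intro R_dich_I[of "\<lambda>p. 0"]) (auto simp: linear_utility_def)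
  next
    case False
    define k e where "k = val r a - val r b" and "e = val r b"
    have d: "k > 0" unfolding k_def using False ab(2)[of "return_pmf b"] by simp
    \<comment> \<open>The indicator of the top level.\<close>
    define g where "g x = (of_bool (val r x = val r a) :: real)" for x
    define u where "u p = (\<Sum>x\<in>UNIV. pmf p x * g x)" for p
    have u: "linear_utility u" "u (return_pmf x) = g x" for x
      unfolding u_def by (rule linear_utility_extension)+
    have "val r x = k * u (return_pmf x) + e" for x
    proof -
      have "val r x = val r a \<or> val r x = val r b"
        using two[where a = a and b = x and c = b] ab(1)[of "return_pmf x"] ab(2)[of "return_pmf x"] by fastforce
      thus ?thesis using d by (auto simp: u g_def k_def e_def)
    qed
    hence "util r p = k * u p + e" for p
      by (rule affine_utility_on_lotteries[OF u(1) linear_util[OF rv], of UNIV])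
         (simp add: lotteries_on_iff)
    hence "utility_represents u r"
      using d by (simp add: utility_represents_def util_represents[OF rv])
    thus ?thesis by (intro R_dich_I[OF u(1)]) (auto simp: u g_def)
  qed
qed

section \<open>Larger approval counts win\<close>

lemma ex_card_between:
  assumes "A \<subseteq> B" "card A \<le> k" "k \<le> card B"
  shows "\<exists>S::'n set. A \<subseteq> S \<and> S \<subseteq> B \<and> card S = k"
  using exists_subset_between[OF assms(2,3,1)] by auto

lemma ex_card:
  assumes "k \<le> card (B :: 'n set)"
  shows "\<exists>S::'n set. card S = k"
  using obtain_subset_with_card_n[OF assms] by metis

text \<open>An auxiliary alternative \<open>c\<close>, approved by a subset of \<open>C a\<close> as
  large as \<open>C b\<close>, ties with \<open>b\<close> by count and is Pareto-dominated by
  \<open>a\<close>. IIA on the pair carries the result back.\<close>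

lemma approval_majority:
  assumes R: "approval_on X C R" "a \<in> X" "b \<in> X" and card: "card (C a) > card (C b)"
  shows "social R a > social R b"
proof -
  have ne: "a \<noteq> b" using card by auto
  obtain c where c: "c \<noteq> a" "c \<noteq> b" using fresh[of a b b] .
  obtain S where S: "S \<subseteq> C a" "card S = card (C b)"
    using ex_card_between[of "{}" "C a" "card (C b)"] card by auto
  obtain R' where R': "approval_on {a, b, c} (C(c := S)) R'"
    using ex_approval_on_triple by blast
  have "social R' c < social R' a"
    using S card c by (intro social_less[OF R']) auto
  moreover have "social R' c = social R' b"
    using S c by (intro approval_tie[OF R']) auto
  ultimately have "social R' a > social R' b" by simp
  moreover have "approval_on {a, b} C R" "approval_on {a, b} (C(c := S)) R'"
    using R R' approval_on_subset[of _ _ _ "{a, b}"] by auto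
  ultimately show ?thesis
    using c by (intro iffD2[OF approval_transfer[of "{a, b}" C R "C(c := S)" R']]) auto
qed

section \<open>Social utility differences are proportional to count differences\<close>

text \<open>Equality of two slopes of social utility against approval counts, cross-multiplied so
  that it remains meaningful when counts coincide.\<close>

abbreviation balanced :: "('n \<Rightarrow> 'a pref) \<Rightarrow> ('a \<Rightarrow> 'n set) \<Rightarrow> 'a \<Rightarrow> 'a \<Rightarrow> 'a \<Rightarrow> bool" where
  "balanced R C a b c \<equiv>
     (social R a - social R b) * (real (card (C b)) - real (card (C c))) =
     (social R b - social R c) * (real (card (C a)) - real (card (C b)))"

text \<open>Being balanced says that \<open>b\<close> is socially indifferent to a lottery between \<open>a\<close> and \<open>c\<close> whose
  weights depend on the approval counts only, hence it is subject to IIA.\<close>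

lemma balanced_extend:
  assumes R: "approval_on {a, b, c} C R" and d: "d \<noteq> a" "d \<noteq> b" "d \<noteq> c"
    and card: "card (C a) > card (C b)" "card (C b) > card (C c)"
  obtains R' where "approval_on {a, b, c, d} (C(d := S)) R'"
    "balanced R' C a b c \<Longrightarrow> balanced R C a b c"
proof -
  \<comment> \<open>\<open>R'\<close> is only known to agree with \<open>R\<close> in ranking
    \<open>a\<close>, \<open>b\<close> and \<open>c\<close>, so balance must be carried back by
    IIA.\<close>
  obtain R' where R': "approval_on {a, b, c, d} (C(d := S)) R'"
    using ex_approval_on_quadruple by blast
  define k l where "k = real (card (C b)) - real (card (C c))"
    and "l = real (card (C a)) - real (card (C b))"
  have kl: "k > 0" "l > 0" using card by (auto simp: k_def l_def)
  \<comment> \<open>With these weights the expected approval count of \<open>m\<close> equals the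
    count of \<open>b\<close>.\<close>
  define m where "m = mix (k / (k + l)) (return_pmf a) (return_pmf c)"
  have 01: "0 \<le> k / (k + l)" "k / (k + l) \<le> 1" using kl by auto
  have bal: "util (f Q) m = social Q b \<longleftrightarrow> (social Q a - social Q b) * k = (social Q b - social Q c) * l"
    if "approval_on {a, b, c} C' Q" for Q C'
  proof -
    have "util (f Q) m = k / (k + l) * social Q a + (1 - k / (k + l)) * social Q c"
      unfolding m_def
      using that by (intro linear_utility_mix linear_util f_vNM 01 approval_on_profiles)
    also have "\<dots> = (k * social Q a + l * social Q c) / (k + l)"
    proof -
      have "1 - k / (k + l) = l / (k + l)" using kl by (simp add: field_simps)
      thus ?thesis by (simp add: add_divide_distrib)
    qed
    finally have m: "util (f Q) m = (k * social Q a + l * social Q c) / (k + l)" .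
    have "k + l \<noteq> 0" using kl by simp
    hence "util (f Q) m = social Q b \<longleftrightarrow> k * social Q a + l * social Q c = social Q b * (k + l)"
      by (simp add: m divide_eq_eq)
    thus ?thesis by (auto simp: algebra_simps)
  qed
  have R'': "approval_on {a, b, c} (C(d := S)) R'"
    using R' by (rule approval_on_subset) auto
  have m: "m \<in> lotteries_on {a, b, c}" "return_pmf b \<in> lotteries_on {a, b, c}"
    by (auto simp: m_def intro!: mix_lotteries_on)
  have "C y = (C(d := S)) y" if "y \<in> {a, b, c}" for y using that d by auto
  hence "util (f R) m = social R b" if "util (f R') m = social R' b"
    using approval_transfer[OF R R'' _ m] approval_transfer[OF R R'' _ m(2,1)] that
    by (metis linorder_neqE less_irrefl)
  hence "balanced R' C a b c \<Longrightarrow> balanced R C a b c"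
    using bal[OF R] bal[OF R''] d by (simp add: k_def l_def)
  thus ?thesis using R' that by blast
qed

text \<open>The alternative \<open>d\<close> is approved by \<open>C c\<close> and the single agent
  in \<open>C a - C b\<close>, so it ties with \<open>b\<close> by count. The parallelogram then
  makes \<open>b\<close> the social midpoint of \<open>a\<close> and \<open>c\<close>.\<close>

lemma balanced_unit_nested:
  assumes R: "approval_on {a, b, c} C R"
    and card: "card (C a) = Suc (card (C b))" "card (C b) = Suc (card (C c))"
    and nested: "C c \<subseteq> C b" "C b \<subseteq> C a"
  shows "balanced R C a b c"
proof -
  have ne: "a \<noteq> b" "b \<noteq> c" "a \<noteq> c" using card by auto
  obtain d where d: "d \<noteq> a" "d \<noteq> b" "d \<noteq> c" using fresh[of a b c] .
  let ?S = "C c \<union> (C a - C b)"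
  obtain R' where R': "approval_on {a, b, c, d} (C(d := ?S)) R'"
    and bal: "balanced R' C a b c \<Longrightarrow> balanced R C a b c"
    using balanced_extend[OF R d, of ?S] card by auto
  have "card ?S = card (C c) + card (C a - C b)"
    using nested by (intro card_Un_disjoint) auto
  also have "\<dots> = card (C b)" using card nested by (simp add: card_Diff_subset)
  finally have "social R' b = social R' d"
    using d by (intro approval_tie[OF R']) auto
  moreover have "social R' a + social R' c = social R' b + social R' d"
    using d nested by (intro social_parallelogram[OF R']) auto
  ultimately show ?thesis using d card by (intro bal) (simp add: algebra_simps)
qed

text \<open>Nestedness is removed in two stages, since only one auxiliary alternative fits at a
  time: \<open>c\<close>, then \<open>a\<close>, is replaced by a tied alternative whose approval
  set is nested with \<open>C b\<close>.\<close>

lemma balanced_unit: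
  assumes R: "approval_on {a, b, c} C R"
    and card: "card (C a) = Suc (card (C b))" "card (C b) = Suc (card (C c))"
  shows "balanced R C a b c"
proof -
  have upper: "balanced R C a b c"
    if R: "approval_on {a, b, c} C R" and nested: "C b \<subseteq> C a"
      and card: "card (C a) = Suc (card (C b))" "card (C b) = Suc (card (C c))" for a b c C R
  proof -
    obtain d where d: "d \<noteq> a" "d \<noteq> b" "d \<noteq> c" using fresh[of a b c] .
    obtain S where S: "S \<subseteq> C b" "card S = card (C c)"
      using ex_card_between[of "{}" "C b" "card (C c)"] card by auto
    obtain R' where R': "approval_on {a, b, c, d} (C(d := S)) R'"
      and bal: "balanced R' C a b c \<Longrightarrow> balanced R C a b c"
      using balanced_extend[OF R d, of S] card by auto
    have "social R' c = social R' d" using d S by (intro approval_tie[OF R']) auto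
    moreover have "balanced R' (C(d := S)) a b d"
      using d S card nested
      by (intro balanced_unit_nested approval_on_subset[OF R']) auto
    ultimately show ?thesis using d S by (intro bal) simp
  qed
  obtain d where d: "d \<noteq> a" "d \<noteq> b" "d \<noteq> c" using fresh[of a b c] .
  obtain S where S: "C b \<subseteq> S" "card S = card (C a)"
    using ex_card_between[of "C b" UNIV "card (C a)"] card card_mono[of UNIV "C a"] by auto
  obtain R' where R': "approval_on {a, b, c, d} (C(d := S)) R'"
    and bal: "balanced R' C a b c \<Longrightarrow> balanced R C a b c"
    using balanced_extend[OF R d, of S] card by auto
  have "social R' a = social R' d" using d S by (intro approval_tie[OF R']) auto
  moreover have "balanced R' (C(d := S)) d b c"
    using d S card by (intro upper approval_on_subset[OF R']) auto
  ultimately show ?thesis using d S by (intro bal) simp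
qed

text \<open>For four points with abscissae \<open>x\<close>, \<open>y\<close>, \<open>z\<close>,
  \<open>w\<close>, the middle interval has positive length and its slope \<open>t\<close> is shared
  by both neighbours; an inner point can then be dropped.\<close>

lemma equal_slopes:
  fixes p q r s :: real
  assumes "(p - q) * (y - z) = (q - r) * (x - y)" "(q - r) * (z - w) = (r - s) * (y - z)" "y > z"
  shows "(p - q) * (y - w) = (q - s) * (x - y)" "(p - r) * (z - w) = (r - s) * (x - z)"
proof -
  define t where "t = (q - r) / (y - z)"
  have q: "q - r = t * (y - z)" using assms(3) by (simp add: t_def)
  have p: "p - q = t * (x - y)" and r: "r - s = t * (z - w)"
    using assms by (simp_all add: t_def eq_divide_eq)
  have "q - s = t * (y - w)" "p - r = t * (x - z)"
    using p q r by (simp_all add: algebra_simps)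
  thus "(p - q) * (y - w) = (q - s) * (x - y)" "(p - r) * (z - w) = (r - s) * (x - z)"
    using p r by simp_all
qed

text \<open>Induction on the spread of counts. If a gap exceeds 1, a fourth alternative is inserted
  in it; the two resulting triples have smaller spread and overlap in one interval, so
  \<open>equal_slopes\<close> joins them.\<close>

lemma approval_balanced_strict:
  assumes "approval_on {a, b, c} C R" "card (C a) > card (C b)" "card (C b) > card (C c)"
  shows "balanced R C a b c"
  using assms
proof (induction "card (C a) - card (C c)" arbitrary: a b c C R rule: less_induct)
  case less
  note R = less.prems(1) and card = less.prems(2,3)
  obtain d where d: "d \<noteq> a" "d \<noteq> b" "d \<noteq> c" using fresh[of a b c] .
  have C': "(C(d := S)) a = C a" "(C(d := S)) b = C b" "(C(d := S)) c = C c" "(C(d := S)) d = S" for S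
    using d by auto
  consider "card (C a) = Suc (card (C b))" "card (C b) = Suc (card (C c))"
    | "card (C a) > Suc (card (C b))" | "card (C b) > Suc (card (C c))"
    using card by linarith
  thus ?case
  proof cases
    case 1
    thus ?thesis by (rule balanced_unit[OF R])
  next
    case 2
    obtain S :: "'n set" where S: "card S = Suc (card (C b))"
      using ex_card[of "Suc (card (C b))" "C a"] 2 by auto
    obtain R' where R': "approval_on {a, b, c, d} (C(d := S)) R'"
      and bal: "balanced R' C a b c \<Longrightarrow> balanced R C a b c"
      using balanced_extend[OF R d, of S] card by auto
    have upper: "balanced R' (C(d := S)) a d b"
      using d S card 2 by (intro less.hyps approval_on_subset[OF R']) auto
    have lower: "balanced R' (C(d := S)) d b c"
      using d S card 2 by (intro less.hyps approval_on_subset[OF R']) auto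
    show ?thesis
      by (rule bal, rule equal_slopes(2)[OF upper[unfolded C'] lower[unfolded C']]) (use S in simp)
  next
    case 3
    obtain S :: "'n set" where S: "card S = Suc (card (C c))"
      using ex_card[of "Suc (card (C c))" "C b"] 3 by auto
    obtain R' where R': "approval_on {a, b, c, d} (C(d := S)) R'"
      and bal: "balanced R' C a b c \<Longrightarrow> balanced R C a b c"
      using balanced_extend[OF R d, of S] card by auto
    have upper: "balanced R' (C(d := S)) a b d"
      using d S card 3 by (intro less.hyps approval_on_subset[OF R']) auto
    have lower: "balanced R' (C(d := S)) b d c"
      using d S card 3 by (intro less.hyps approval_on_subset[OF R']) auto
    show ?thesis
      by (rule bal, rule equal_slopes(1)[OF upper[unfolded C'] lower[unfolded C']]) (use S 3 in simp)
  qed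
qed

text \<open>The cross-multiplied equation is invariant under permuting the triple, and ties by count
  make it trivial, so the strict case suffices.\<close>

lemma approval_balanced:
  assumes "approval_on {a, b, c} C R"
  shows "balanced R C a b c"
proof -
  let ?n = "\<lambda>x. card (C x)"
  have tie: "social R x = social R y" if "?n x = ?n y" "x \<in> {a, b, c}" "y \<in> {a, b, c}" for x y
    using approval_tie[OF assms that(2,3,1)] .
  have strict: "balanced R C x y z"
    if "?n x > ?n y" "?n y > ?n z" "x \<in> {a, b, c}" "y \<in> {a, b, c}" "z \<in> {a, b, c}" for x y z
    using that by (intro approval_balanced_strict approval_on_subset[OF assms]) auto
  consider "?n a = ?n b" | "?n b = ?n c" | "?n a = ?n c"
    | "?n a > ?n b" "?n b > ?n c" | "?n a > ?n c" "?n c > ?n b" | "?n b > ?n a" "?n a > ?n c"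
    | "?n b > ?n c" "?n c > ?n a" | "?n c > ?n a" "?n a > ?n b" | "?n c > ?n b" "?n b > ?n a"
    by linarith
  thus ?thesis
  proof cases
    case 1 thus ?thesis using tie[of a b] by simp
  next
    case 2 thus ?thesis using tie[of b c] by simp
  next
    case 3 thus ?thesis using tie[of a c] by (simp add: algebra_simps)
  next
    case 4 thus ?thesis by (intro strict) auto
  next
    case 5
    hence "balanced R C a c b" by (intro strict) auto
    thus ?thesis by (simp add: algebra_simps)
  next
    case 6
    hence "balanced R C b a c" by (intro strict) auto
    thus ?thesis by (simp add: algebra_simps)
  next
    case 7
    hence "balanced R C b c a" by (intro strict) auto
    thus ?thesis by (simp add: algebra_simps)
  next
    case 8
    hence "balanced R C c a b" by (intro strict) auto
    thus ?thesis by (simp add: algebra_simps)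
  next
    case 9
    hence "balanced R C c b a" by (intro strict) auto
    thus ?thesis by (simp add: algebra_simps)
  qed
qed

section \<open>Utilitarian representation and the equivalence\<close>

text \<open>The sum \<open>n\<close> of 0/1 utilities is the approval count on pure alternatives.
  Balance and majority make social utility a positive affine function of it, first there and then on
  all lotteries.\<close>

lemma utilitarian:
  assumes "CARD('n) \<ge> 2"
  shows "utilitarian D f"
  unfolding utilitarian_def
proof
  fix R :: "'n \<Rightarrow> 'a pref" assume R: "R \<in> profiles D"
  have "\<forall>i. \<exists>u. linear_utility u \<and> utility_represents u (R i) \<and> (\<forall>a. u (return_pmf a) \<in> {0, 1})"
    using R D_subset_R_dich[OF assms] unfolding profiles_def R_dich_def by blast
  then obtain u where u: "\<And>i. linear_utility (u i)" "\<And>i. utility_represents (u i) (R i)"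
    "\<And>i a. u i (return_pmf a) \<in> {0, 1}" by metis
  define n where "n p = (\<Sum>i\<in>UNIV. u i p)" for p
  have lin: "linear_utility n"
    unfolding linear_utility_def
  proof
    fix p
    have "n p = (\<Sum>i\<in>UNIV. \<Sum>a\<in>UNIV. pmf p a * u i (return_pmf a))"
      unfolding n_def using u(1) unfolding linear_utility_def by (intro sum.cong refl) blast
    also have "\<dots> = (\<Sum>a\<in>UNIV. \<Sum>i\<in>UNIV. pmf p a * u i (return_pmf a))" by (rule sum.swap)
    finally show "n p = (\<Sum>a\<in>UNIV. pmf p a * n (return_pmf a))"
      by (simp add: n_def sum_distrib_left)
  qed
  define C where "C a = {i. u i (return_pmf a) = 1}" for a
  have u_C: "u i (return_pmf a) = of_bool (i \<in> C a)" for i a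
    using u(3)[of i a] by (auto simp: C_def)
  have n_C: "n (return_pmf a) = card (C a)" for a
    by (simp add: n_def u_C)
  \<comment> \<open>The preferences are now dichotomous on all alternatives, so \<open>X\<close> may
    even be \<open>UNIV\<close>.\<close>
  have C: "approval_on X C R" for X
    unfolding approval_on_def
  proof (intro conjI R allI ballI)
    fix i x y
    have "val (R i) x > val (R i) y \<longleftrightarrow> (return_pmf x, return_pmf y) \<in> R i"
      by (simp add: util_represents profile_vNM R)
    also have "\<dots> \<longleftrightarrow> u i (return_pmf x) > u i (return_pmf y)"
      using u(2) by (simp add: utility_represents_def)
    finally show "val (R i) x > val (R i) y \<longleftrightarrow> i \<in> C x \<and> i \<notin> C y" by (auto simp: u_C)
  qed
  have "\<exists>c d. c > 0 \<and> (\<forall>x. social R x = c * n (return_pmf x) + d)"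
  proof (cases "\<exists>a b. card (C a) > card (C b)")
    case True
    then obtain a b where ab: "card (C a) > card (C b)" by blast
    define c where "c = (social R a - social R b) / (real (card (C a)) - real (card (C b)))"
    have c: "c > 0" using approval_majority[OF C, of a UNIV b] ab by (simp add: c_def)
    have "social R x = c * n (return_pmf x) + (social R b - c * card (C b))" for x
    proof -
      have "social R a - social R b = c * (real (card (C a)) - real (card (C b)))"
        using ab by (simp add: c_def)
      \<comment> \<open>Balance of \<open>a\<close>, \<open>b\<close>, \<open>x\<close>; the nonzero
        count difference of \<open>a\<close> and \<open>b\<close> cancels next.\<close>
      hence "(c * (real (card (C b)) - real (card (C x)))) * (real (card (C a)) - real (card (C b))) =
          (social R b - social R x) * (real (card (C a)) - real (card (C b)))"
        using approval_balanced[OF C, of a b x] by (simp add: mult.assoc mult.commute)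
      hence "c * (real (card (C b)) - real (card (C x))) = social R b - social R x"
        using ab by simp
      thus ?thesis by (simp add: n_C algebra_simps)
    qed
    thus ?thesis using c by blast
  next
    case False
    \<comment> \<open>All counts agree, so all alternatives tie and slope 1 serves.\<close>
    hence eq: "card (C x) = card (C y)" for x y by (metis linorder_neqE_nat)
    fix y
    have "social R x = 1 * n (return_pmf x) + (social R y - n (return_pmf y))" for x
      using approval_tie[OF C _ _ eq, of x UNIV y] eq[of x y] by (simp add: n_C)
    thus ?thesis using zero_less_one by blast
  qed
  then obtain c d where c: "c > 0" and d: "\<And>x. social R x = c * n (return_pmf x) + d" by blast
  have aff: "util (f R) p = c * n p + d" for p
    using d by (rule affine_utility_on_lotteries[OF lin linear_util[OF f_vNM[OF R]], of UNIV])
      (simp add: lotteries_on_iff)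
  have "(\<Sum>i\<in>UNIV. the_SSB (R i) p q) = n p - n q" for p q
    by (simp add: the_SSB_dichotomous[OF u] n_def sum_subtractf)
  thus "SSB_represents (\<lambda>p q. \<Sum>i\<in>UNIV. the_SSB (R i) p q) (f R)"
    using c by (simp add: SSB_represents_def util_represents f_vNM R aff)
qed

end

theorem corollary2:
  fixes D :: "'a::finite pref set"
    and f :: "('n::finite \<Rightarrow> 'a pref) \<Rightarrow> 'a pref"
  assumes "CARD('a) \<ge> 4"
    and "CARD('n) \<ge> 2"
    and "D \<subseteq> R_vNM"
    and "R5 D"
    and "SWF D R_vNM f"
    and "anonymous D f"
  shows "arrovian D f \<longleftrightarrow> utilitarian D f \<and> D \<subseteq> R_dich"
proof
  assume "arrovian D f"
  then interpret arrovian_swf D f using assms by unfold_locales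
  show "utilitarian D f \<and> D \<subseteq> R_dich" using utilitarian D_subset_R_dich assms(2) by blast
qed (use utilitarian_imp_arrovian in blast)

end
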